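(* Let $d,k\ge 1$ and let $\mathcal U=\{U_1,\dots,U_n\}$ be a $k$-flexible sunflower in $\mathbb R^d$ consisting of convex open sets. Suppose $n\ge dk+1$, and for each $i\in[n]$ let $p_i\in U_i$. Then $\operatorname{conv}\{p_1,\dots,p_n\}$ contains a point of the center $U_1\cap\cdots\cap U_n$. Moreover, if $d\ge 2$ this may fail when $n<dk+1$: for every $d\ge2$ and $k\ge1$ there is an open $k$-flexible sunflower in $\mathbb R^d$ with $n=dk$ petals and points $p_i\in U_i$ such that $\operatorname{conv}\{p_1,\dots,p_n\}$ contains no point of the center.
   Context: For $\mathcal U=\{U_1,\dots,U_n\}$ subsets of $\mathbb R^d$, $U_\sigma=\bigcap_{i\in\sigma}U_i$ ($U_\emptyset=\mathbb R^d$) and $\operatorname{code}(\mathcal U)=\{\sigma\subseteq[n] : U_\sigma\setminus\bigcup_{j\notin\sigma}U_j\neq\emptyset\}$. A collection $\mathcal U$ of convex sets in $\mathbb R^d$ is a $k$-flexible sunflower if $[n]\in\operatorname{code}(\mathcal U)$ and every other codeword of $\operatorname{code}(\mathcal U)$ has at most $k$ elements. The $U_i$ are its petals and $U_{[n]}$ its center. *)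

theory Defs
  imports "HOL-Analysis.Analysis"
begin

text \<open>
  A collection \<open>U\<^sub>1, \<dots>, U\<^sub>n\<close> is an indexed family, so repetitions are allowed; it is given by
  a function on \<open>nat\<close>, of which only the values on \<open>{1..n}\<close> matter.
  For \<open>\<sigma> = {}\<close> the intersection is \<open>UNIV\<close>, the whole space.
\<close>

definition code_of :: "nat \<Rightarrow> (nat \<Rightarrow> 'a set) \<Rightarrow> nat set set" where
  "code_of n U = {\<sigma>. \<sigma> \<subseteq> {1..n} \<and> (\<Inter>i\<in>\<sigma>. U i) - (\<Union>j\<in>{1..n} - \<sigma>. U j) \<noteq> {}}"

definition flexible_sunflower :: "nat \<Rightarrow> nat \<Rightarrow> (nat \<Rightarrow> 'a::real_vector set) \<Rightarrow> bool" where
  "flexible_sunflower k n U \<longleftrightarrow>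
     (\<forall>i\<in>{1..n}. convex (U i)) \<and>
     {1..n} \<in> code_of n U \<and>
     (\<forall>\<sigma>\<in>code_of n U. \<sigma> \<noteq> {1..n} \<longrightarrow> card \<sigma> \<le> k)"

definition center :: "nat \<Rightarrow> (nat \<Rightarrow> 'a set) \<Rightarrow> 'a set" where
  "center n U = (\<Inter>i\<in>{1..n}. U i)"

end

theory Submission
  imports Defs
begin

text \<open>
  Suppose the hull of the \<open>p\<^sub>i\<close> misses the center \<open>C\<close>. As \<open>dk < n\<close>, Helly's theorem yields a point
  \<open>x\<close> of the hull such that every half-space containing \<open>x\<close> but not a fixed \<open>c \<in> C\<close> contains more
  than \<open>k\<close> of the \<open>p\<^sub>i\<close>. Slide a small ball from \<open>c\<close> towards \<open>x\<close> until it touches the boundary of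
  \<open>C\<close> at a point \<open>y\<close>. Because of the ball, an open convex \<open>U\<^sub>i \<supseteq> C\<close> with \<open>y \<notin> U\<^sub>i\<close> lies on one side
  of the tangent hyperplane of the ball at \<open>y\<close>. More than \<open>k\<close> petals contain a point (close to \<open>p\<^sub>i\<close>)
  on the other side, hence contain \<open>y\<close>; so \<open>y\<close> is in the center, a contradiction.

  For sharpness, take the \<open>d\<close> petals \<open>{x. \<forall>j\<noteq>i. x\<^sub>j > 0}\<close>, each repeated \<open>k\<close> times; the center is the
  open positive orthant, and the \<open>p\<^sub>i\<close> can be chosen in the hyperplane \<open>\<Sum>\<^sub>j x\<^sub>j = 0\<close>.
\<close>

text \<open>A hyperplane separating \<open>y\<close> from \<open>W\<close> has the whole ball on one
  side and passes no farther from it than \<open>y\<close>, so it is tangent at \<open>y\<close> and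
  its normal is a positive multiple of \<open>m - y\<close>.\<close>

lemma touching_ball_supports:
  fixes W :: "'a::euclidean_space set"
  assumes "convex W" "open W" "ball m r \<subseteq> W" "y \<notin> W" "dist m y = r" "0 < r" "z \<in> W"
  shows "0 \<le> (m - y) \<bullet> (z - y)"
proof -
  obtain a b where a: "a \<noteq> 0" "a \<bullet> y \<le> b" "\<forall>w\<in>W. b \<le> a \<bullet> w"
    using separating_hyperplane_sets[of "{y}" W] assms by auto
  have sup: "0 \<le> a \<bullet> (w - y)" if "w \<in> W" for w
    using a that by (fastforce simp: inner_diff_right)
  have nrm: "norm (m - y) = r" using assms by (simp add: dist_norm)
  \<comment> \<open>Test points at distance \<open>s\<close> from \<open>m\<close> in direction
    \<open>-a\<close>; letting \<open>s\<close> tend to \<open>r\<close> yields the equality case of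
    Cauchy-Schwarz.\<close>
  have "s \<le> a \<bullet> (m - y) / norm a" if "0 < s" "s < r" for s
  proof -
    have "m - (s / norm a) *\<^sub>R a \<in> ball m r"
      using that a by (simp add: dist_norm)
    then have "0 \<le> a \<bullet> (m - (s / norm a) *\<^sub>R a - y)" using sup assms by blast
    then have "s * norm a \<le> a \<bullet> (m - y)"
      using a by (simp add: inner_diff_right dot_square_norm power2_eq_square)
    then show ?thesis using a by (simp add: field_simps)
  qed
  then have "r \<le> a \<bullet> (m - y) / norm a" using \<open>0 < r\<close> dense_le_bounded by blast
  then have "norm a * norm (m - y) \<le> a \<bullet> (m - y)" using a nrm by (simp add: field_simps)
  then have "norm a *\<^sub>R (m - y) = norm (m - y) *\<^sub>R a"
    using norm_cauchy_schwarz_eq norm_cauchy_schwarz by (metis order_antisym)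
  then have "norm a * ((m - y) \<bullet> (z - y)) = r * (a \<bullet> (z - y))"
    using nrm by (metis inner_scaleR_left)
  moreover have "0 \<le> r * (a \<bullet> (z - y))" using sup assms by simp
  ultimately have "0 \<le> norm a * ((m - y) \<bullet> (z - y))" by simp
  then show ?thesis using a by (simp add: zero_le_mult_iff)
qed

lemma hull_centerpoint:
  fixes p :: "nat \<Rightarrow> 'a::euclidean_space"
  assumes "DIM('a) * k < n"
  obtains x where "x \<in> convex hull (p ` {1..n})"
    and "\<And>h. h \<bullet> x < h \<bullet> c \<Longrightarrow> k < card {i\<in>{1..n}. h \<bullet> p i \<le> h \<bullet> x}"
proof -
  \<comment> \<open>Since \<open>c\<close> lies in every \<open>D M\<close>, only subfamilies
    containing \<open>P\<close> matter in Helly's theorem. These have at most \<open>DIM('a)\<close>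
    further members, whence the bound \<open>DIM('a) * k < n\<close>.\<close>
  define D where "D M = convex hull (insert c (p ` ({1..n} - M)))" for M
  define \<M> where "\<M> = {M. M \<subseteq> {1..n} \<and> card M \<le> k}"
  define P where "P = convex hull (p ` {1..n})"
  define F where "F = insert P (D ` \<M>)"
  have finM: "finite \<M>" unfolding \<M>_def by (rule finite_subset[of _ "Pow {1..n}"]) auto
  then have finF: "finite F" by (simp add: F_def)
  have small: "\<Inter>G \<noteq> {}" if G: "G \<subseteq> F" "card G \<le> DIM('a) + 1" for G
  proof (cases "P \<in> G")
    case False
    have "c \<in> D M" for M by (simp add: D_def hull_inc)
    then have "c \<in> \<Inter>G" using False G by (auto simp: F_def)
    then show ?thesis by blast
  next
    case True
    have finG: "finite G" using G finF finite_subset by blast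
    have "G - {P} \<subseteq> D ` \<M>" using G by (auto simp: F_def)
    then obtain N where N: "N \<subseteq> \<M>" "finite N" "inj_on D N" "D ` N = G - {P}"
      using finG by (metis finite_Diff finite_imageD subset_image_inj)
    have "card N = card G - 1" using N True finG card_image by fastforce
    then have cN: "card N \<le> DIM('a)" using G by simp
    have "card (\<Union>N) \<le> sum card N" by (rule card_Union_le_sum_card)
    also have "\<dots> \<le> card N * k" using sum_bounded_above[of N card k] N by (auto simp: \<M>_def)
    also have "\<dots> < n" using cN assms by (meson le_less_trans mult_le_mono1)
    finally have "card (\<Union>N) < card {1..n}" by simp
    moreover have "\<Union>N \<subseteq> {1..n}" using N(1) unfolding \<M>_def by blast
    then have "finite (\<Union>N)" by (rule finite_subset) simp
    ultimately have "\<not> {1..n} \<subseteq> \<Union>N" using card_mono not_less by blast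
    then obtain j where j: "j \<in> {1..n}" "j \<notin> \<Union>N" by blast
    have "p j \<in> D M" if "M \<in> N" for M
      using that j by (auto simp: D_def intro!: hull_inc)
    moreover have "p j \<in> P" using j by (auto simp: P_def intro!: hull_inc)
    ultimately have "p j \<in> \<Inter>G" using N by (metis InterI imageE insertE insert_Diff True)
    then show ?thesis by blast
  qed
  \<comment> \<open>\<open>Helly\<close> assumes at least \<open>DIM('a) + 1\<close> sets; a smaller
    family is covered by \<open>small\<close> with \<open>G = F\<close>.\<close>
  have "\<Inter>F \<noteq> {}"
  proof (cases "card F \<le> DIM('a) + 1")
    case False
    show ?thesis
    proof (rule Helly)
      show "\<forall>s\<in>F. convex s" by (auto simp: F_def D_def P_def)
    qed (use False small in auto)
  qed (use small in auto)
  then obtain x where x: "x \<in> P" "\<And>M. M \<in> \<M> \<Longrightarrow> x \<in> D M" by (auto simp: F_def)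
  show ?thesis
  proof (rule that)
    show "x \<in> convex hull (p ` {1..n})" using x by (simp add: P_def)
    fix h assume h: "h \<bullet> x < h \<bullet> c"
    show "k < card {i\<in>{1..n}. h \<bullet> p i \<le> h \<bullet> x}" (is "_ < card ?M")
    proof (rule ccontr)
      assume "\<not> ?thesis"
      then have "?M \<in> \<M>" by (auto simp: \<M>_def)
      then have "x \<in> D ?M" by (rule x)
      \<comment> \<open>After deleting \<open>?M\<close>, all generators of the hull,
        \<open>c\<close> included, lie strictly beyond \<open>x\<close>.\<close>
      moreover have "D ?M \<subseteq> {z. h \<bullet> x < h \<bullet> z}" unfolding D_def
        by (rule hull_minimal) (use h in \<open>auto simp: convex_halfspace_gt\<close>)
      ultimately show False by auto
    qed
  qed
qed

text \<open>The indices of the petals through \<open>y\<close> form a codeword, with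
  \<open>y\<close> as witness.\<close>

lemma flexible_sunflower_center_memI:
  assumes "flexible_sunflower k n U" "k < card {i\<in>{1..n}. y \<in> U i}"
  shows "y \<in> center n U"
proof -
  let ?s = "{i\<in>{1..n}. y \<in> U i}"
  have "?s \<in> code_of n U" unfolding code_of_def by blast
  then have "?s = {1..n}" using assms unfolding flexible_sunflower_def by fastforce
  then show ?thesis unfolding center_def by blast
qed

lemma hull_meets_center:
  fixes U :: "nat \<Rightarrow> 'a::euclidean_space set"
  assumes fs: "flexible_sunflower k n U"
    and op: "\<forall>i\<in>{1..n}. open (U i)"
    and n: "DIM('a) * k < n"
    and p: "\<forall>i\<in>{1..n}. p i \<in> U i"
  shows "convex hull (p ` {1..n}) \<inter> center n U \<noteq> {}"
proof
  assume disj: "convex hull (p ` {1..n}) \<inter> center n U = {}"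
  let ?C = "center n U"
  have cvU: "convex (U i)" if "i \<in> {1..n}" for i
    using fs that by (simp add: flexible_sunflower_def)
  have cvC: "convex ?C" unfolding center_def using cvU by (intro convex_INT) auto
  have opC: "open ?C" unfolding center_def using op by (intro open_INT) auto
  have subU: "?C \<subseteq> U i" if "i \<in> {1..n}" for i using that by (auto simp: center_def)
  have "?C \<noteq> {}" using fs by (auto simp: flexible_sunflower_def code_of_def center_def)
  then obtain c where c: "c \<in> ?C" by blast
  obtain x where x: "x \<in> convex hull (p ` {1..n})"
    and many: "\<And>h. h \<bullet> x < h \<bullet> c \<Longrightarrow> k < card {i\<in>{1..n}. h \<bullet> p i \<le> h \<bullet> x}"
    using hull_centerpoint[OF n] by blast
  have xC: "x \<notin> ?C" using x disj by blast
  \<comment> \<open>The sliding ball has radius \<open>r\<close>; the margin \<open>2 * r\<close>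
    leaves room for the shift \<open>v\<close> below.\<close>
  obtain r where r: "0 < r" "ball c (2 * r) \<subseteq> ?C" "\<And>i. i \<in> {1..n} \<Longrightarrow> ball (p i) (2 * r) \<subseteq> U i"
  proof -
    obtain e where e: "0 < e" "ball c e \<subseteq> ?C" using opC c openE by blast
    have "\<forall>i\<in>{1..n}. \<exists>e>0. ball (p i) e \<subseteq> U i" using op p openE by metis
    then obtain g where g: "\<And>i. i \<in> {1..n} \<Longrightarrow> 0 < g i \<and> ball (p i) (g i) \<subseteq> U i" by metis
    define s where "s = Min (insert e (g ` {1..n}))"
    have "0 < s" using e g by (auto simp: s_def)
    moreover have "s \<le> e" "\<And>i. i \<in> {1..n} \<Longrightarrow> s \<le> g i"
      unfolding s_def by (rule Min_le; simp)+
    ultimately show ?thesis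
      using e g subset_ball[of s] by (intro that[of "s / 2"]) (simp, force, simp, blast)
  qed
  define m where "m t = (1 - t) *\<^sub>R c + t *\<^sub>R x" for t :: real
  \<comment> \<open>For \<open>m t\<close> in \<open>?C\<close>, this is the radius of the largest
    open ball around \<open>m t\<close> inside \<open>?C\<close>.\<close>
  define \<phi> where "\<phi> t = infdist (m t) (- ?C)" for t
  have ne: "- ?C \<noteq> {}" using xC by blast
  have cl: "closed (- ?C)" using opC by (simp add: closed_Compl)
  have "2 * r \<le> \<phi> 0"
    unfolding \<phi>_def infdist_notempty[OF ne]
  proof (rule cINF_greatest[OF ne])
    fix z assume "z \<in> - ?C"
    then show "2 * r \<le> dist (m 0) z" using r(2) by (fastforce simp: m_def not_less[symmetric])
  qed
  moreover have "\<phi> 1 = 0" using xC by (simp add: \<phi>_def m_def)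
  moreover have "continuous_on {0..1} \<phi>" unfolding \<phi>_def m_def by (intro continuous_intros)
  ultimately obtain t where t: "0 \<le> t" "t \<le> 1" "\<phi> t = r"
    using IVT2'[of \<phi> 1 r 0] r(1) by auto
  have t0: "0 < t" using t \<open>2 * r \<le> \<phi> 0\<close> r(1) by (cases "t = 0") auto
  obtain y where y: "y \<notin> ?C" "dist (m t) y = r"
    using infdist_attains_inf[OF cl ne, of "m t"] t(3) unfolding \<phi>_def by (metis ComplD)
  have ball: "ball (m t) r \<subseteq> ?C"
  proof
    fix z assume "z \<in> ball (m t) r"
    then show "z \<in> ?C" using infdist_le[of z "- ?C" "m t"] t(3) unfolding \<phi>_def by force
  qed
  define h where "h = m t - y"
  have nh: "norm h = r" using y by (simp add: h_def dist_norm)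
  \<comment> \<open>The factor lies strictly between 1 and 2: below 2 keeps \<open>c - v\<close> in
    the center and \<open>p i - v\<close> in its petal, above 1 makes the final inequalities
    strict.\<close>
  define v where "v = (3 / 2) *\<^sub>R h"
  have nv: "norm v < 2 * r" "h \<bullet> v = 3 / 2 * r\<^sup>2"
    using r nh by (simp_all add: v_def dot_square_norm)
  have "c - v \<in> ?C" using r(2) nv by (auto simp: dist_norm)
  then have "0 \<le> h \<bullet> (c - v - y)"
    unfolding h_def by (intro touching_ball_supports[OF cvC opC ball y r(1)])
  then have hc: "3 / 2 * r\<^sup>2 \<le> h \<bullet> (c - y)" using nv by (simp add: inner_diff_right)
  \<comment> \<open>The value at \<open>m t\<close> is a weighted mean of those at \<open>c\<close>
    and \<open>x\<close>. As the one at \<open>c\<close> exceeds \<open>r\<^sup>2\<close>, the one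
    at \<open>x\<close> cannot.\<close>
  have "r\<^sup>2 = h \<bullet> (m t - y)" using nh by (simp add: h_def dot_square_norm)
  also have "\<dots> = (1 - t) * (h \<bullet> (c - y)) + t * (h \<bullet> (x - y))"
    by (simp add: m_def inner_diff_right inner_add_right algebra_simps)
  finally have eq: "r\<^sup>2 = (1 - t) * (h \<bullet> (c - y)) + t * (h \<bullet> (x - y))" .
  have r2: "0 < r\<^sup>2" using r by simp
  have "(1 - t) * r\<^sup>2 \<le> (1 - t) * (h \<bullet> (c - y))"
    by (rule mult_left_mono) (use hc r2 t in linarith)+
  then have "t * (h \<bullet> (x - y)) \<le> t * r\<^sup>2"
    using eq left_diff_distrib[of 1 t "r\<^sup>2"] by simp
  then have hx: "h \<bullet> (x - y) \<le> r\<^sup>2" using t0 by simp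
  have "h \<bullet> x < h \<bullet> c" using hx hc r2 unfolding inner_diff_right by linarith
  then have "k < card {i\<in>{1..n}. h \<bullet> p i \<le> h \<bullet> x}" by (rule many)
  also have "\<dots> \<le> card {i\<in>{1..n}. y \<in> U i}"
  proof (rule card_mono)
    show "{i\<in>{1..n}. h \<bullet> p i \<le> h \<bullet> x} \<subseteq> {i\<in>{1..n}. y \<in> U i}"
    proof safe
      fix i assume i: "i \<in> {1..n}" and le: "h \<bullet> p i \<le> h \<bullet> x"
      show "y \<in> U i"
      proof (rule ccontr)
        assume "y \<notin> U i"
        \<comment> \<open>The shift is needed because \<open>p i\<close> itself may lie on the
          ball's side of the tangent hyperplane at \<open>y\<close>.\<close>
        moreover have "p i - v \<in> U i" using r(3)[OF i] nv by (auto simp: dist_norm)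
        ultimately have "0 \<le> h \<bullet> (p i - v - y)"
          unfolding h_def
          using touching_ball_supports[of "U i" "m t" r y] cvU[OF i] op i ball subU[OF i] y r(1)
          by blast
        then show False using le hx nv r2 unfolding inner_diff_right by linarith
      qed
    qed
  qed simp
  finally show False using flexible_sunflower_center_memI[OF fs] y by blast
qed

lemma orthant_sunflower:
  assumes d: "CARD('d::finite) \<ge> 2" and k: "k \<ge> 1"
  shows "\<exists>(U :: nat \<Rightarrow> (real ^ 'd) set) p.
     flexible_sunflower k (CARD('d) * k) U \<and>
     (\<forall>i\<in>{1..CARD('d) * k}. open (U i)) \<and>
     (\<forall>i\<in>{1..CARD('d) * k}. p i \<in> U i) \<and>
     convex hull (p ` {1..CARD('d) * k}) \<inter> center (CARD('d) * k) U = {}"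
proof -
  let ?n = "CARD('d) * k"
  obtain e :: "nat \<Rightarrow> 'd" where e: "bij_betw e {0..<CARD('d)} UNIV"
    using ex_bij_betw_nat_finite[of "UNIV :: 'd set"] by auto
  \<comment> \<open>Indices start at 1, hence \<open>i - 1\<close>; each block of \<open>k\<close>
    consecutive petals shares the unconstrained coordinate \<open>g i\<close>.\<close>
  define g where "g i = e ((i - 1) div k)" for i
  define U where "U i = {v :: real ^ 'd. \<forall>j. j \<noteq> g i \<longrightarrow> 0 < v $ j}" for i
  \<comment> \<open>The entry \<open>1 - real CARD('d)\<close> makes the coordinates sum to
    0.\<close>
  define p where "p i = (\<chi> j. if j = g i then 1 - real CARD('d) else 1)" for i
  have fibre: "card {i\<in>{1..?n}. g i = a} \<le> k" for a
  proof -
    obtain b where b: "b < CARD('d)" "e b = a" using e unfolding bij_betw_def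
      by (metis UNIV_I atLeastLessThan_iff imageE)
    have "{i\<in>{1..?n}. g i = a} \<subseteq> {b * k + 1..b * k + k}"
    proof safe
      fix i assume i: "i \<in> {1..?n}" "a = g i"
      then have "i - 1 < CARD('d) * k" by auto
      then have "(i - 1) div k < CARD('d)" by (simp add: less_mult_imp_div_less)
      then have "(i - 1) div k = b" using b i e unfolding bij_betw_def inj_on_def g_def by auto
      then have "b * k + (i - 1) mod k = i - 1" by (metis div_mult_mod_eq)
      moreover have "(i - 1) mod k < k" using i by (cases k) auto
      ultimately show "i \<in> {b * k + 1..b * k + k}" using i by auto
    qed
    then show ?thesis using card_mono[of "{b * k + 1..b * k + k}"] by fastforce
  qed
  have surj: "\<exists>i\<in>{1..?n}. g i = a" for a
  proof -
    obtain b where b: "b < CARD('d)" "e b = a" using e unfolding bij_betw_def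
      by (metis UNIV_I atLeastLessThan_iff imageE)
    then have "Suc b * k \<le> ?n" by (intro mult_le_mono1) simp
    then have "b * k + 1 \<in> {1..?n}" using k by auto
    moreover have "g (b * k + 1) = a" using k b by (simp add: g_def)
    ultimately show ?thesis by blast
  qed
  \<comment> \<open>Each of the two petals constrains the coordinate that the other leaves free.
    Hence a codeword other than \<open>{1..?n}\<close> stays within one block.\<close>
  have orth: "v \<in> U i'" if "v \<in> U i" "v \<in> U j" "g i \<noteq> g j" for v i j i'
  proof -
    have "0 < v $ a" for a using that by (cases "a = g i") (auto simp: U_def)
    then show ?thesis by (simp add: U_def)
  qed
  have Ueq: "U i = (\<Inter>j\<in>- {g i}. {v. 0 < v $ j})" for i by (auto simp: U_def)
  have "convex (U i)" for i
  proof -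
    have "convex {v :: real ^ 'd. 0 < v $ j}" for j
      using convex_halfspace_gt[of 0 "axis j (1 :: real)"] by (simp add: inner_axis')
    then show ?thesis unfolding Ueq by (intro convex_INT)
  qed
  moreover have "{1..?n} \<in> code_of ?n U"
  proof -
    have "(1 :: real ^ 'd) \<in> U i" for i by (simp add: U_def)
    then show ?thesis by (auto simp: code_of_def)
  qed
  moreover have "card s \<le> k" if s: "s \<in> code_of ?n U" "s \<noteq> {1..?n}" for s
  proof -
    obtain v where v: "s \<subseteq> {1..?n}" "\<And>i. i \<in> s \<Longrightarrow> v \<in> U i" "\<And>j. j \<in> {1..?n} - s \<Longrightarrow> v \<notin> U j"
      using s(1) unfolding code_of_def by blast
    have same: "g i = g j" if "i \<in> s" "j \<in> s" for i j
      using orth[of v i j] v that s(2) by blast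
    show ?thesis
    proof (cases "s = {}")
      case False
      then obtain i where "i \<in> s" by blast
      then have "s \<subseteq> {j\<in>{1..?n}. g j = g i}" using same v by blast
      then have "card s \<le> card {j\<in>{1..?n}. g j = g i}" by (intro card_mono) auto
      then show ?thesis using fibre order_trans by blast
    qed simp
  qed
  ultimately have "flexible_sunflower k ?n U" by (auto simp: flexible_sunflower_def)
  moreover have "open (U i)" for i
    unfolding Ueq by (intro open_INT) (auto intro!: open_Collect_less continuous_intros)
  moreover have "p i \<in> U i" for i by (simp add: U_def p_def)
  moreover have "convex hull (p ` {1..?n}) \<inter> center ?n U = {}"
  proof -
    \<comment> \<open>Here \<open>1\<close> is the all-ones vector, so \<open>1 \<bullet> v\<close>
      is the coordinate sum.\<close>
    let ?H = "{v :: real ^ 'd. 1 \<bullet> v = 0}"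
    have "1 \<bullet> p i = 0" for i
      by (simp add: p_def inner_vec_def sum.If_cases Collect_neg_eq[symmetric] card_Diff_singleton Compl_eq_Diff_UNIV)
    then have "convex hull (p ` {1..?n}) \<subseteq> ?H"
      by (intro hull_minimal convex_hyperplane) auto
    moreover have "0 < 1 \<bullet> v" if v: "v \<in> center ?n U" for v
    proof -
      have "0 < v $ j" for j
      proof -
        \<comment> \<open>A second coordinate \<open>a\<close> is required: a petal leaving
          \<open>a\<close> free constrains \<open>j\<close>.\<close>
        have "card {j} < CARD('d)" using d by simp
        then obtain a where "a \<noteq> j" by (metis UNIV_eq_I card.empty less_irrefl singletonI)
        moreover obtain i where "i \<in> {1..?n}" "g i = a" using surj by blast
        ultimately show ?thesis using v by (auto simp: center_def U_def)
      qed
      then show ?thesis by (simp add: inner_vec_def sum_pos)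
    qed
    ultimately show ?thesis by force
  qed
  ultimately show ?thesis by blast
qed

theorem theorem1p11:
  shows "(\<forall>(k::nat) (n::nat) (U :: nat \<Rightarrow> (real ^ 'd) set) (p :: nat \<Rightarrow> real ^ 'd).
            k \<ge> 1 \<longrightarrow>
            flexible_sunflower k n U \<longrightarrow>
            (\<forall>i\<in>{1..n}. open (U i)) \<longrightarrow>
            n \<ge> CARD('d) * k + 1 \<longrightarrow>
            (\<forall>i\<in>{1..n}. p i \<in> U i) \<longrightarrow>
            convex hull (p ` {1..n}) \<inter> center n U \<noteq> {})
       \<and> (CARD('d) \<ge> 2 \<longrightarrow>
            (\<forall>k::nat. k \<ge> 1 \<longrightarrow>
              (\<exists>(U :: nat \<Rightarrow> (real ^ 'd) set) (p :: nat \<Rightarrow> real ^ 'd).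
                 flexible_sunflower k (CARD('d) * k) U \<and>
                 (\<forall>i\<in>{1..CARD('d) * k}. open (U i)) \<and>
                 (\<forall>i\<in>{1..CARD('d) * k}. p i \<in> U i) \<and>
                 convex hull (p ` {1..CARD('d) * k}) \<inter> center (CARD('d) * k) U = {})))"
proof (intro conjI allI impI)
  fix k n :: nat and U :: "nat \<Rightarrow> (real ^ 'd) set" and p
  assume "flexible_sunflower k n U" "\<forall>i\<in>{1..n}. open (U i)" "\<forall>i\<in>{1..n}. p i \<in> U i"
    and "CARD('d) * k + 1 \<le> n"
  then show "convex hull (p ` {1..n}) \<inter> center n U \<noteq> {}"
    by (intro hull_meets_center) (simp_all add: Suc_le_eq)
qed (rule orthant_sunflower)

end
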